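(* The sequence $\left(|I_k(123,132,213)|\right)_{k\ge 0}$ enumerates the Pascal triangle read by diagonals, offset by two elements, in the following sense: the term for $k=0$ is $\binom{1}{1}$, and the terms for $k=1,2,3,\dots$ are the binomial coefficients $\binom{n}{m}$ with $n\ge 2$ and $m\ge 0$ (including those equal to $0$ because $m>n$), listed in increasing order of $n+m$, and among those with the same value of $n+m$ in increasing order of $n$. Furthermore \[\sum_{k\ge 0}|I_k(123,132,213)|\,x^k=1+x+\sum_{d\ge 3}x^{1+\binom{d-1}{2}}\sum_{n=2}^{d}\binom{n}{d-n}x^{n-2}.\]
   Context: A permutation of length $n$ is a word $\pi=\pi_1\cdots\pi_n$ containing each of $1,\dots,n$ exactly once. The sum of permutations $\rho=\rho_1\cdots\rho_n$ and $\tau=\tau_1\cdots\tau_m$ is the permutation $\rho\oplus\tau=\rho_1\cdots\rho_n(n+\tau_1)\cdots(n+\tau_m)$ of length $n+m$. A permutation is decomposable if it equals $\rho\oplus\tau$ for some non-empty permutations $\rho,\tau$; a non-empty permutation that is not decomposable is indecomposable. An inversion of $\pi$ is a pair $(i,j)$ with $i<j$ and $\pi_i>\pi_j$. A permutation $\pi$ contains a permutation (pattern) $\tau=\tau_1\cdots\tau_m$ if there are indices $i_1<\dots<i_m$ such that $\pi_{i_1},\dots,\pi_{i_m}$ is order-isomorphic to $\tau_1,\dots,\tau_m$; otherwise $\pi$ avoids $\tau$. $I_k(\tau_1,\dots,\tau_r)$ denotes the (finite) set of all indecomposable permutations, of any length, with exactly $k$ inversions that avoid all of $\tau_1,\dots,\tau_r$.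 *)

theory Defs
  imports
    "HOL-Analysis.Infinite_Sum"
    "HOL-Computational_Algebra.Formal_Power_Series"
    "HOL-Combinatorics.Multiset_Permutations"
    "HOL-Library.Sublist"
begin

definition perm_word :: "nat list \<Rightarrow> bool" where
  "perm_word \<pi> \<longleftrightarrow> \<pi> \<in> permutations_of_set {1..length \<pi>}"

definition perm_sum :: "nat list \<Rightarrow> nat list \<Rightarrow> nat list" where
  "perm_sum \<rho> \<tau> = \<rho> @ map (\<lambda>x. length \<rho> + x) \<tau>"

definition decomposable :: "nat list \<Rightarrow> bool" where
  "decomposable \<pi> \<longleftrightarrow>
     (\<exists>\<rho> \<tau>. perm_word \<rho> \<and> perm_word \<tau> \<and> \<rho> \<noteq> [] \<and> \<tau> \<noteq> [] \<and> \<pi> = perm_sum \<rho> \<tau>)"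

definition indecomposable :: "nat list \<Rightarrow> bool" where
  "indecomposable \<pi> \<longleftrightarrow> perm_word \<pi> \<and> \<pi> \<noteq> [] \<and> \<not> decomposable \<pi>"

text \<open>Positions are counted from 0 here, as usual for lists; entries are counted from 1.\<close>

definition inversions :: "nat list \<Rightarrow> (nat \<times> nat) set" where
  "inversions \<pi> = {(i, j). i < j \<and> j < length \<pi> \<and> \<pi> ! i > \<pi> ! j}"

definition order_isomorphic :: "nat list \<Rightarrow> nat list \<Rightarrow> bool" where
  "order_isomorphic xs ys \<longleftrightarrow> length xs = length ys \<and>
     (\<forall>i<length xs. \<forall>j<length xs. xs ! i < xs ! j \<longleftrightarrow> ys ! i < ys ! j)"

definition contains_pattern :: "nat list \<Rightarrow> nat list \<Rightarrow> bool" where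
  "contains_pattern \<pi> \<tau> \<longleftrightarrow> (\<exists>\<sigma>. subseq \<sigma> \<pi> \<and> order_isomorphic \<sigma> \<tau>)"

definition indec_avoiders :: "nat \<Rightarrow> nat list set \<Rightarrow> nat list set" where
  "indec_avoiders k T = {\<pi>. indecomposable \<pi> \<and> card (inversions \<pi>) = k \<and>
     (\<forall>\<tau>\<in>T. \<not> contains_pattern \<pi> \<tau>)}"

text \<open>The order in which the pairs \<open>(n, m)\<close> of indices of binomial coefficients are listed:
  by \<open>n + m\<close>, and by \<open>n\<close> within a diagonal.\<close>

definition diag_less :: "nat \<times> nat \<Rightarrow> nat \<times> nat \<Rightarrow> bool" where
  "diag_less p q \<longleftrightarrow> fst p + snd p < fst q + snd q \<or>
     (fst p + snd p = fst q + snd q \<and> fst p < fst q)"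

text \<open>The sets \<^const>\<open>indec_avoiders\<close> are finite, so their \<^const>\<open>card\<close> is their true size.\<close>

lemma finite_inversions: "finite (inversions \<pi>)"
proof (rule finite_subset)
  show "inversions \<pi> \<subseteq> {..<length \<pi>} \<times> {..<length \<pi>}"
    by (auto simp: inversions_def)
qed simp

lemma inversion_width:
  assumes "(a, b) \<in> inversions \<pi>"
  shows "b - a \<le> card (inversions \<pi>)"
proof -
  define f where "f c = (if \<pi> ! c < \<pi> ! a then (a, c) else (c, b))" for c
  have ab: "a < b" "b < length \<pi>" "\<pi> ! b < \<pi> ! a"
    using assms by (auto simp: inversions_def)
  have "inj_on f {a<..b}"
    using ab by (auto simp: inj_on_def f_def split: if_splits)
  moreover have "f ` {a<..b} \<subseteq> inversions \<pi>"
    using ab by (auto simp: f_def inversions_def order.order_iff_strict)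
  ultimately have "card {a<..b} \<le> card (inversions \<pi>)"
    using finite_inversions card_inj_on_le by blast
  then show ?thesis by simp
qed

lemma indecomposable_cut:
  assumes "indecomposable \<pi>" "0 < i" "i < length \<pi>"
  obtains a b where "(a, b) \<in> inversions \<pi>" "a < i" "i \<le> b"
proof -
  let ?n = "length \<pi>" and ?\<rho> = "take i \<pi>" and ?\<sigma> = "drop i \<pi>"
  have pi: "set \<pi> = {1..?n}" "distinct \<pi>"
    using assms(1) by (auto simp: indecomposable_def perm_word_def permutations_of_set_def)
  have un: "set ?\<rho> \<union> set ?\<sigma> = {1..?n}"
    using pi(1) by (simp flip: set_append)
  have sub: "set ?\<rho> \<subseteq> {1..?n}"
    using un by blast
  have dj: "set ?\<rho> \<inter> set ?\<sigma> = {}"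
    using pi(2) by (simp add: set_take_disj_set_drop_if_distinct)
  have c\<rho>: "card (set ?\<rho>) = i"
    using pi(2) assms(3) by (simp add: distinct_card)
  have "\<exists>a b. (a, b) \<in> inversions \<pi> \<and> a < i \<and> i \<le> b"
  proof (rule ccontr)
    assume no: "\<not> ?thesis"
    have less: "x < y" if xy: "x \<in> set ?\<rho>" "y \<in> set ?\<sigma>" for x y
    proof -
      obtain a where "a < length ?\<rho>" "?\<rho> ! a = x"
        using xy(1) unfolding in_set_conv_nth by blast
      then have a: "a < i" "x = \<pi> ! a"
        by auto
      obtain c where c: "c < length ?\<sigma>" "?\<sigma> ! c = y"
        using xy(2) unfolding in_set_conv_nth by blast
      define b where "b = i + c"
      have b: "i \<le> b" "b < ?n" "y = \<pi> ! b"
        using c assms(3) by (auto simp: b_def)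
      have "\<not> y < x"
        using no a b by (fastforce simp: inversions_def)
      moreover have "x \<noteq> y"
        using xy dj by auto
      ultimately show ?thesis by simp
    qed
    have down: "x \<in> set ?\<rho>" if "y \<in> set ?\<rho>" "x \<le> y" "1 \<le> x" for x y
    proof (rule ccontr)
      assume "x \<notin> set ?\<rho>"
      moreover have "x \<in> {1..?n}" using that subsetD[OF sub that(1)] by auto
      ultimately have "x \<in> set ?\<sigma>" using un by blast
      then show False using less[OF that(1)] that(2) by fastforce
    qed
    define M where "M = Max (set ?\<rho>)"
    have ne: "set ?\<rho> \<noteq> {}" using c\<rho> assms(2) by auto
    have "set ?\<rho> = {1..M}"
    proof
      show "set ?\<rho> \<subseteq> {1..M}" using sub by (auto simp: M_def)
      have "M \<in> set ?\<rho>" unfolding M_def using ne by (intro Max_in) auto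
      then show "{1..M} \<subseteq> set ?\<rho>" using down by auto
    qed
    moreover from this have "M = i" using c\<rho> by simp
    ultimately have s\<rho>: "set ?\<rho> = {1..i}" by blast
    have s\<sigma>: "set ?\<sigma> = {i<..?n}"
    proof -
      have "set ?\<sigma> = {1..?n} - {1..i}" using un dj s\<rho> by blast
      also have "\<dots> = {i<..?n}" by auto
      finally show ?thesis .
    qed
    define \<tau> where "\<tau> = map (\<lambda>x. x - i) ?\<sigma>"
    have "set \<tau> = {1..?n - i}"
    proof -
      have "(\<lambda>x. x - i) ` {i<..?n} = {1..?n - i}"
      proof
        show "{1..?n - i} \<subseteq> (\<lambda>x. x - i) ` {i<..?n}"
        proof
          fix y assume "y \<in> {1..?n - i}"
          then have "y + i \<in> {i<..?n}" "y = (y + i) - i" by auto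
          then show "y \<in> (\<lambda>x. x - i) ` {i<..?n}" by blast
        qed
      qed auto
      then show ?thesis by (simp add: \<tau>_def s\<sigma>)
    qed
    moreover have "distinct \<tau>"
      unfolding \<tau>_def distinct_map using pi(2) s\<sigma> by (auto simp: inj_on_def)
    ultimately have "perm_word \<tau>"
      by (simp add: perm_word_def permutations_of_set_def \<tau>_def)
    moreover have "perm_word ?\<rho>"
      using s\<rho> pi(2) assms(3) by (simp add: perm_word_def permutations_of_set_def min_def)
    moreover have "\<pi> = perm_sum ?\<rho> \<tau>"
    proof -
      have "map (\<lambda>x. i + x) \<tau> = ?\<sigma>"
        unfolding \<tau>_def map_map by (rule map_idI) (use s\<sigma> in auto)
      then show ?thesis using assms(3) by (simp add: perm_sum_def min_def)
    qed
    moreover have "?\<rho> \<noteq> []" "\<tau> \<noteq> []"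
      using assms(2,3) by (auto simp: \<tau>_def)
    ultimately have "decomposable \<pi>"
      unfolding decomposable_def by blast
    then show False using assms(1) by (simp add: indecomposable_def)
  qed
  then show ?thesis using that by blast
qed

lemma indecomposable_length_le:
  assumes "indecomposable \<pi>"
  shows "length \<pi> \<le> card (inversions \<pi>) * card (inversions \<pi>) + 1"
proof -
  let ?I = "inversions \<pi>"
  have "{0<..<length \<pi>} \<subseteq> (\<Union>(a, b)\<in>?I. {a<..b})"
  proof
    fix i assume "i \<in> {0<..<length \<pi>}"
    then obtain a b where "(a, b) \<in> ?I" "a < i" "i \<le> b"
      using indecomposable_cut[OF assms, of i] by auto
    then show "i \<in> (\<Union>(a, b)\<in>?I. {a<..b})" by force
  qed
  then have "card {0<..<length \<pi>} \<le> card (\<Union>(a, b)\<in>?I. {a<..b})"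
    using finite_inversions by (intro card_mono) auto
  also have "\<dots> \<le> (\<Sum>p\<in>?I. card (case p of (a, b) \<Rightarrow> {a<..b}))"
    by (rule card_UN_le[OF finite_inversions])
  also have "\<dots> \<le> (\<Sum>p\<in>?I. card ?I)"
    using inversion_width by (intro sum_mono) auto
  finally show ?thesis by simp
qed

lemma finite_indec_avoiders: "finite (indec_avoiders k T)"
proof (rule finite_subset)
  show "indec_avoiders k T \<subseteq> {\<pi>. set \<pi> \<subseteq> {1..k * k + 1} \<and> length \<pi> \<le> k * k + 1}"
  proof
    fix \<pi> assume "\<pi> \<in> indec_avoiders k T"
    then have i: "indecomposable \<pi>" and "card (inversions \<pi>) = k"
      by (auto simp: indec_avoiders_def)
    then have "length \<pi> \<le> k * k + 1"
      using indecomposable_length_le by blast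
    moreover have "set \<pi> = {1..length \<pi>}"
      using i by (auto simp: indecomposable_def perm_word_def permutations_of_set_def)
    ultimately show "\<pi> \<in> {\<pi>. set \<pi> \<subseteq> {1..k * k + 1} \<and> length \<pi> \<le> k * k + 1}"
      by auto
  qed
qed (rule finite_lists_length_le, simp)

end

theory Submission
  imports Defs
begin

text \<open>
  The three patterns \<open>123\<close>, \<open>132\<close>, \<open>213\<close> are exactly the permutations of length three whose
  first entry is smaller than the last one. Avoiding all of them therefore means that any two
  entries at distance at least two form an inversion (\<open>avoids_iff_far_inverted\<close>). If \<open>\<pi>\<close> has
  length \<open>N \<ge> 2\<close>, then either \<open>\<pi>\<close> starts with \<open>N\<close>, or it starts with \<open>N - 1\<close>, \<open>N\<close>; in both
  cases the rest is an arbitrary avoider of the remaining length (\<open>avoiders_Suc_Suc\<close>). So the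
  avoiders of length \<open>N\<close> correspond to the compositions of \<open>N\<close> into parts 1 and 2, and an avoider
  with \<open>m\<close> parts equal to 2 misses exactly \<open>m\<close> of the \<open>N choose 2\<close> possible inversions. Hence
  there are \<open>(N - m) choose m\<close> avoiders of length \<open>N\<close> with \<open>(N choose 2) - m\<close> inversions
  (\<open>card_avoiders_with\<close>).

  A decomposable avoider has no inversions, being \<open>12\<close> (\<open>far_inverted_decomposable\<close>), so for
  \<open>k \<ge> 1\<close> every avoider with \<open>k\<close> inversions counts. Put \<open>n = N - m\<close>. As \<open>2 * m \<le> N\<close>, having
  an inversion forces \<open>n \<ge> 2\<close>. For fixed \<open>N = n + m\<close>, the numbers \<open>(N choose 2) - m\<close> with
  \<open>2 \<le> n \<le> N\<close> run in increasing order of \<open>n\<close> through the interval from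
  \<open>((N - 1) choose 2) + 1\<close> to \<open>N choose 2\<close>, and for \<open>N \<ge> 2\<close> these intervals partition the positive
  integers. So each \<open>k \<ge> 1\<close> is the position of exactly one pair \<open>(n, m)\<close> in the listing by
  diagonals (\<open>diag_index_bij\<close>), and the number of avoiders is \<open>n choose m\<close>
  (\<open>card_indec_avoiders_diag_index\<close>). In the generating function, the summand for \<open>d\<close> collects the
  terms of the diagonal \<open>n + m = d\<close>.
\<close>

section \<open>Permutations whose non-adjacent entries are decreasing\<close>

text \<open>
  Any two entries at distance at least two are in weakly decreasing order; for words with distinct
  entries this says that they form an inversion.
\<close>

fun far_inverted :: "nat list \<Rightarrow> bool" where
  "far_inverted [] \<longleftrightarrow> True"
| "far_inverted (x # p) \<longleftrightarrow> (\<forall>z\<in>set (tl p). z \<le> x) \<and> far_inverted p"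

lemma perm_word_iff: "perm_word \<pi> \<longleftrightarrow> set \<pi> = {1..length \<pi>} \<and> distinct \<pi>"
  by (auto simp: perm_word_def permutations_of_set_def)

lemma subseq_pair_tl_iff: "(\<exists>y. subseq [y, z] p) \<longleftrightarrow> z \<in> set (tl p)"
proof (cases p)
  case (Cons a q)
  have "z \<in> set q" if "subseq [y, z] q" for y
    using that subseq_Cons' subseq_Cons2' subseq_Cons2_neq by (metis subseq_singleton_left)
  moreover have "subseq [a, z] p" if "z \<in> set q"
    using that by (simp add: Cons subseq_singleton_left)
  ultimately show ?thesis
    unfolding Cons by (auto simp: subseq_singleton_left split: if_splits)
qed simp

lemma far_inverted_iff_subseq:
  "far_inverted \<pi> \<longleftrightarrow> (\<forall>x y z. subseq [x, y, z] \<pi> \<longrightarrow> z \<le> x)"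
proof (induction \<pi>)
  case (Cons a p)
  have "(\<forall>x y z. subseq [x, y, z] (a # p) \<longrightarrow> z \<le> x) \<longleftrightarrow>
    (\<forall>z. (\<exists>y. subseq [y, z] p) \<longrightarrow> z \<le> a) \<and> (\<forall>x y z. subseq [x, y, z] p \<longrightarrow> z \<le> x)"
    by (auto intro: subseq_Cons' split: if_splits)
  then show ?case
    unfolding subseq_pair_tl_iff by (simp add: Cons.IH Ball_def)
qed simp

lemma contains_pattern_three:
  "contains_pattern \<pi> [a, b, c] \<longleftrightarrow>
    (\<exists>x y z. subseq [x, y, z] \<pi> \<and> order_isomorphic [x, y, z] [a, b, c])"
proof
  assume "contains_pattern \<pi> [a, b, c]"
  then obtain \<sigma> where sub: "subseq \<sigma> \<pi>" "order_isomorphic \<sigma> [a, b, c]"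
    by (auto simp: contains_pattern_def)
  then have "length \<sigma> = Suc (Suc (Suc 0))"
    by (simp add: order_isomorphic_def)
  then obtain x y z where "\<sigma> = [x, y, z]"
    by (auto simp: length_Suc_conv)
  then show "\<exists>x y z. subseq [x, y, z] \<pi> \<and> order_isomorphic [x, y, z] [a, b, c]"
    using sub by blast
qed (auto simp: contains_pattern_def)

lemma avoids_iff_far_inverted:
  assumes "distinct \<pi>"
  shows "(\<forall>\<tau>\<in>{[1,2,3], [1,3,2], [2,1,3]}. \<not> contains_pattern \<pi> \<tau>) \<longleftrightarrow> far_inverted \<pi>"
proof -
  have iso: "order_isomorphic [x, y, z] [1,2,3] \<or> order_isomorphic [x, y, z] [1,3,2] \<or>
      order_isomorphic [x, y, z] [2,1,3] \<longleftrightarrow> x < z"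
    if "subseq [x, y, z] \<pi>" for x y z
  proof -
    have "distinct [x, y, z]"
      using that assms subseq_conv_nths distinct_nthsI by metis
    then show ?thesis
      by (auto simp: order_isomorphic_def numeral_eq_Suc All_less_Suc2)
  qed
  have "(\<forall>\<tau>\<in>{[1,2,3], [1,3,2], [2,1,3]}. \<not> contains_pattern \<pi> \<tau>) \<longleftrightarrow>
    (\<forall>x y z. subseq [x, y, z] \<pi> \<longrightarrow> \<not> x < z)"
    unfolding ball_simps contains_pattern_three using iso by blast
  then show ?thesis
    by (simp add: far_inverted_iff_subseq not_less)
qed

text \<open>The permutations of length \<open>N\<close>, decomposable or not, that avoid the three patterns.\<close>

definition avoiders :: "nat \<Rightarrow> nat list set" where
  "avoiders N = {\<pi>. perm_word \<pi> \<and> length \<pi> = N \<and> far_inverted \<pi>}"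

lemma finite_avoiders [simp]: "finite (avoiders N)"
  by (rule finite_subset[of _ "permutations_of_set {1..N}"])
    (auto simp: avoiders_def perm_word_def)

lemma avoiders_0: "avoiders 0 = {[]}"
  by (auto simp: avoiders_def perm_word_iff)

lemma avoiders_1: "avoiders (Suc 0) = {[1]}"
  by (auto simp: avoiders_def perm_word_iff length_Suc_conv)

lemma avoiders_Suc_Suc:
  "avoiders (Suc (Suc N)) =
    (#) (N + 2) ` avoiders (Suc N) \<union> (\<lambda>p. (N + 1) # (N + 2) # p) ` avoiders N"
proof (intro equalityI subsetI)
  fix \<pi> assume "\<pi> \<in> avoiders (Suc (Suc N))"
  then have pi: "set \<pi> = {1..N + 2}" "distinct \<pi>" "length \<pi> = N + 2" "far_inverted \<pi>"
    by (auto simp: avoiders_def perm_word_iff)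
  then obtain x y q where xyq: "\<pi> = x # y # q"
    by (auto simp: length_Suc_conv numeral_eq_Suc)
  have less: "z < x" if "z \<in> set q" for z
    using pi that by (auto simp: xyq le_less)
  have "x \<le> N + 2" using pi(1) by (auto simp: xyq)
  \<comment> \<open>The maximum cannot occur in \<open>q\<close>, whose entries are all smaller than \<open>x\<close>.\<close>
  have "N + 2 \<in> set \<pi>" using pi(1) by simp
  then consider "x = N + 2" | "y = N + 2"
    using less[of "N + 2"] \<open>x \<le> N + 2\<close> by (auto simp: xyq)
  then show "\<pi> \<in> (#) (N + 2) ` avoiders (Suc N) \<union> (\<lambda>p. (N + 1) # (N + 2) # p) ` avoiders N"
  proof cases
    case 1
    have "set (y # q) = set \<pi> - {x}" using pi(2) by (auto simp: xyq)
    also have "\<dots> = {1..N + 1}" unfolding pi(1) 1 by auto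
    finally have "y # q \<in> avoiders (Suc N)"
      using pi by (simp add: xyq avoiders_def perm_word_iff)
    then show ?thesis using 1 xyq by blast
  next
    case 2
    have "N + 1 \<in> set \<pi>" using pi(1) by simp
    moreover have "N + 1 \<notin> set q"
      using less[of "N + 1"] \<open>x \<le> N + 2\<close> pi(2) 2 by (auto simp: xyq)
    ultimately have x: "x = N + 1" using 2 by (auto simp: xyq)
    have "set q = set \<pi> - {x, y}" using pi(2) by (auto simp: xyq)
    also have "\<dots> = {1..N}" unfolding pi(1) x 2 by auto
    finally have "q \<in> avoiders N"
      using pi by (simp add: xyq avoiders_def perm_word_iff)
    then show ?thesis using 2 x xyq by blast
  qed
next
  fix \<pi> assume "\<pi> \<in> (#) (N + 2) ` avoiders (Suc N) \<union> (\<lambda>p. (N + 1) # (N + 2) # p) ` avoiders N"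
  then consider p where "\<pi> = (N + 2) # p" "p \<in> avoiders (Suc N)"
    | p where "\<pi> = (N + 1) # (N + 2) # p" "p \<in> avoiders N"
    by blast
  then show "\<pi> \<in> avoiders (Suc (Suc N))"
  proof cases
    case 1
    then have "set (tl p) \<subseteq> {1..Suc N}"
      by (cases p) (auto simp: avoiders_def perm_word_iff)
    then show ?thesis using 1
      by (auto simp: avoiders_def perm_word_iff)
  next
    case 2
    then have "set (tl p) \<subseteq> {1..N}"
      by (cases p) (auto simp: avoiders_def perm_word_iff)
    then show ?thesis using 2
      by (auto simp: avoiders_def perm_word_iff)
  qed
qed

section \<open>Counting by inversions\<close>

lemma card_inversions_Cons:
  "card (inversions (x # p)) = length (filter (\<lambda>y. y < x) p) + card (inversions p)"
proof -
  let ?A = "(\<lambda>j. (0, Suc j)) ` {j. j < length p \<and> p ! j < x}"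
  let ?B = "map_prod Suc Suc ` inversions p"
  have "inversions (x # p) = ?A \<union> ?B"
  proof (intro equalityI subsetI)
    fix q assume q: "q \<in> inversions (x # p)"
    obtain i j where ij: "q = (i, Suc j)" "i < Suc j" "j < length p" "(x # p) ! i > p ! j"
      using q by (cases q; cases "snd q") (auto simp: inversions_def)
    show "q \<in> ?A \<union> ?B"
    proof (cases i)
      case (Suc i')
      then have "(i', j) \<in> inversions p" using ij by (auto simp: inversions_def)
      then show ?thesis using ij Suc by (force simp: image_iff)
    qed (use ij in auto)
  qed (auto simp: inversions_def)
  moreover have "?A \<inter> ?B = {}" by auto
  moreover have "card ?A = length (filter (\<lambda>y. y < x) p)"
    by (simp add: card_image inj_on_def length_filter_conv_card)
  moreover have "card ?B = card (inversions p)"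
    by (intro card_image) (auto simp: inj_on_def)
  ultimately show ?thesis
    by (simp add: card_Un_disjoint finite_inversions)
qed

lemma Suc_choose_two: "Suc n choose 2 = n + (n choose 2)"
  by (simp add: numeral_2_eq_2)

lemma card_inversions_le: "card (inversions \<pi>) \<le> length \<pi> choose 2"
proof (induction \<pi>)
  case (Cons x p)
  then show ?case
    using length_filter_le[of "\<lambda>y. y < x" p]
    by (simp add: card_inversions_Cons Suc_choose_two add_mono)
qed (simp add: inversions_def)

lemma card_inversions_avoider_1:
  assumes "p \<in> avoiders (Suc N)"
  shows "card (inversions ((N + 2) # p)) = N + 1 + card (inversions p)"
proof -
  have "filter (\<lambda>y. y < N + 2) p = p"
    using assms by (auto simp: filter_id_conv avoiders_def perm_word_iff)
  then show ?thesis using assms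
    unfolding card_inversions_Cons by (simp add: avoiders_def)
qed

lemma card_inversions_avoider_2:
  assumes "p \<in> avoiders N"
  shows "card (inversions ((N + 1) # (N + 2) # p)) = 2 * N + card (inversions p)"
proof -
  have "filter (\<lambda>y. y < N + 2) p = p" "filter (\<lambda>y. y < N + 1) p = p"
    using assms by (auto simp: filter_id_conv avoiders_def perm_word_iff)
  then show ?thesis using assms
    unfolding card_inversions_Cons by (simp add: avoiders_def)
qed

text \<open>
  The avoiders of length \<open>N\<close> that miss exactly \<open>m\<close> of the possible inversions. Stating the deficit
  as a sum avoids truncated subtraction.
\<close>

definition avoiders_with :: "nat \<Rightarrow> nat \<Rightarrow> nat list set" where
  "avoiders_with N m = {\<pi> \<in> avoiders N. card (inversions \<pi>) + m = N choose 2}"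

lemma finite_avoiders_with [simp]: "finite (avoiders_with N m)"
  by (simp add: avoiders_with_def)

lemma avoiders_with_Suc_Suc:
  "avoiders_with (Suc (Suc N)) m = (#) (N + 2) ` avoiders_with (Suc N) m \<union>
    (if m = 0 then {} else (\<lambda>p. (N + 1) # (N + 2) # p) ` avoiders_with N (m - 1))"
proof -
  have A: "(N + 2) # p \<in> avoiders_with (Suc (Suc N)) m \<longleftrightarrow> p \<in> avoiders_with (Suc N) m"
    if "p \<in> avoiders (Suc N)" for p
  proof -
    have "(N + 2) # p \<in> avoiders (Suc (Suc N))" using that by (auto simp: avoiders_Suc_Suc)
    then show ?thesis using that card_inversions_avoider_1[OF that]
      by (simp add: avoiders_with_def Suc_choose_two)
  qed
  have B: "(N + 1) # (N + 2) # p \<in> avoiders_with (Suc (Suc N)) m \<longleftrightarrow>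
      m \<noteq> 0 \<and> p \<in> avoiders_with N (m - 1)"
    if "p \<in> avoiders N" for p
  proof -
    have "(N + 1) # (N + 2) # p \<in> avoiders (Suc (Suc N))"
      using that by (auto simp: avoiders_Suc_Suc)
    moreover have "card (inversions p) \<le> N choose 2"
      using card_inversions_le[of p] that by (simp add: avoiders_def)
    ultimately show ?thesis using that card_inversions_avoider_2[OF that]
      by (auto simp: avoiders_with_def Suc_choose_two)
  qed
  have sub: "avoiders_with M k \<subseteq> avoiders M" for M k
    by (auto simp: avoiders_with_def)
  have "avoiders_with (Suc (Suc N)) m =
      {\<pi> \<in> (#) (N + 2) ` avoiders (Suc N). \<pi> \<in> avoiders_with (Suc (Suc N)) m} \<union>
      {\<pi> \<in> (\<lambda>p. (N + 1) # (N + 2) # p) ` avoiders N. \<pi> \<in> avoiders_with (Suc (Suc N)) m}"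
    using sub[of "Suc (Suc N)" m] unfolding avoiders_Suc_Suc by blast
  also have "{\<pi> \<in> (#) (N + 2) ` avoiders (Suc N). \<pi> \<in> avoiders_with (Suc (Suc N)) m} =
      (#) (N + 2) ` avoiders_with (Suc N) m"
    using A sub[of "Suc N" m] by blast
  also have "{\<pi> \<in> (\<lambda>p. (N + 1) # (N + 2) # p) ` avoiders N.
        \<pi> \<in> avoiders_with (Suc (Suc N)) m} =
      (if m = 0 then {} else (\<lambda>p. (N + 1) # (N + 2) # p) ` avoiders_with N (m - 1))"
    using B sub[of N "m - 1"] by (cases "m = 0") (simp, blast)+
  finally show ?thesis .
qed

lemma card_avoiders_with: "card (avoiders_with N m) = (N - m) choose m"
proof (induction N arbitrary: m rule: induct_nat_012)
  case 0
  have "avoiders_with 0 m = (if m = 0 then {[]} else {})"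
    by (auto simp: avoiders_with_def avoiders_0 inversions_def)
  then show ?case by simp
next
  case 1
  have "inversions [Suc 0] = {}" by (auto simp: inversions_def)
  then have "avoiders_with (Suc 0) m = (if m = 0 then {[1]} else {})"
    by (auto simp: avoiders_with_def avoiders_1)
  then show ?case by (cases m) auto
next
  case (ge2 N)
  have A: "card ((#) (N + 2) ` avoiders_with (Suc N) m) = (Suc N - m) choose m"
    using ge2(2) by (simp add: card_image)
  show ?case
  proof (cases m)
    case 0
    then show ?thesis using A by (simp add: avoiders_with_Suc_Suc)
  next
    case (Suc k)
    have B: "card ((\<lambda>p. (N + 1) # (N + 2) # p) ` avoiders_with N k) = (N - k) choose k"
      using ge2(1) by (simp add: card_image inj_on_def)
    have "card (avoiders_with (Suc (Suc N)) m) = ((Suc N - m) choose m) + ((N - k) choose k)"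
      unfolding avoiders_with_Suc_Suc using Suc A B by (subst card_Un_disjoint) auto
    also have "\<dots> = (Suc (Suc N) - m) choose m"
    proof (cases "m \<le> Suc N")
      case True
      then have "Suc (Suc N) - m = Suc (N - k)" "Suc N - m = N - k"
        using Suc by auto
      then show ?thesis by (simp add: Suc)
    qed (use Suc in auto)
    finally show ?thesis .
  qed
qed

section \<open>Listing the pairs by diagonals\<close>

text \<open>
  The position, counted from 1, of the pair \<open>(n, m)\<close> with \<open>n \<ge> 2\<close> in the listing by diagonals: the
  diagonals \<open>2, \<dots>, n + m - 1\<close> contain \<open>1 + \<dots> + (n + m - 2)\<close> pairs altogether, and \<open>(n, m)\<close> is
  number \<open>n - 1\<close> on its own diagonal.
\<close>

definition diag_index :: "nat \<times> nat \<Rightarrow> nat" where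
  "diag_index p = ((fst p + snd p - 1) choose 2) + (fst p - 1)"

text \<open>
  The position of \<open>(n, m)\<close> is the number of inversions of an avoider of length \<open>n + m\<close> with
  deficit \<open>m\<close>.
\<close>

lemma diag_index_add:
  assumes "2 \<le> n"
  shows "diag_index (n, m) + m = (n + m) choose 2"
proof -
  obtain n' where "n = Suc n'" using assms by (cases n) auto
  then show ?thesis by (simp add: diag_index_def Suc_choose_two)
qed

lemma diag_index_strict_mono:
  assumes "2 \<le> fst p" "2 \<le> fst q" "diag_less p q"
  shows "diag_index p < diag_index q"
proof (cases "fst p + snd p < fst q + snd q")
  case True
  have "diag_index p \<le> (fst p + snd p) choose 2"
    using diag_index_add[of "fst p" "snd p"] assms(1) by simp
  also have "\<dots> \<le> (fst q + snd q - 1) choose 2"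
    using True by (intro binomial_right_mono) auto
  also have "\<dots> < diag_index q"
    using assms(2) by (simp add: diag_index_def)
  finally show ?thesis .
qed (use assms in \<open>auto simp: diag_less_def diag_index_def\<close>)

lemma diag_less_total: "p = q \<or> diag_less p q \<or> diag_less q p"
  by (cases p; cases q) (auto simp: diag_less_def)

lemma diag_index_inj: "inj_on diag_index {(n, m). 2 \<le> n}"
proof (rule inj_onI)
  fix p q assume "p \<in> {(n, m). 2 \<le> n}" "q \<in> {(n, m). 2 \<le> n}" "diag_index p = diag_index q"
  then show "p = q"
    using diag_less_total[of p q] diag_index_strict_mono[of p q] diag_index_strict_mono[of q p]
    by auto
qed

lemma diag_index_surj: "1 \<le> k \<Longrightarrow> \<exists>n m. 2 \<le> n \<and> diag_index (n, m) = k"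
proof (induction k rule: nat_induct_at_least)
  case base
  have "diag_index (2, 0) = 1" by (simp add: diag_index_def)
  then show ?case by blast
next
  case (Suc k)
  then obtain n m where nm: "2 \<le> n" "diag_index (n, m) = k" by blast
  show ?case
  proof (cases m)
    case 0
    have "diag_index (2, n - 1) = Suc k"
      using nm diag_index_add[of n 0] 0 by (simp add: diag_index_def)
    then show ?thesis by blast
  next
    case (Suc m')
    have "diag_index (Suc n, m') = Suc k"
      using nm Suc by (simp add: diag_index_def)
    then show ?thesis using nm(1) by (metis le_SucI)
  qed
qed

lemma diag_index_bij: "bij_betw diag_index {(n, m). 2 \<le> n} {1..}"
  unfolding bij_betw_def using diag_index_inj diag_index_surj
  by (force simp: diag_index_def)

section \<open>Indecomposable avoiders\<close>

text \<open>
  The first entry of a sum is smaller than every entry of the second summand. Since it may only be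
  exceeded by its right neighbour, both summands have length one.
\<close>

lemma far_inverted_decomposable:
  assumes "far_inverted \<pi>" "decomposable \<pi>"
  shows "inversions \<pi> = {}"
proof -
  obtain \<rho> \<tau> where dec: "perm_word \<rho>" "perm_word \<tau>" "\<rho> \<noteq> []" "\<tau> \<noteq> []" "\<pi> = perm_sum \<rho> \<tau>"
    using assms(2) by (auto simp: decomposable_def)
  obtain x \<rho>' where rho: "\<rho> = x # \<rho>'" using dec(3) by (cases \<rho>) auto
  obtain y \<tau>' where tau: "\<tau> = y # \<tau>'" using dec(4) by (cases \<tau>) auto
  have x: "x \<le> length \<rho>" using dec(1) by (auto simp: rho perm_word_iff)
  have pos: "1 \<le> z" if "z \<in> set \<tau>" for z using that dec(2) by (auto simp: perm_word_iff)
  have far: "z \<le> x" if "z \<in> set (tl (\<rho>' @ map (\<lambda>x. length \<rho> + x) \<tau>))" for z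
    using assms(1) that by (simp add: dec(5) perm_sum_def rho)
  have "\<rho>' = []"
  proof (rule ccontr)
    assume "\<rho>' \<noteq> []"
    then have "length \<rho> + y \<le> x" by (intro far) (simp add: tau)
    then show False using x pos[of y] by (simp add: tau)
  qed
  moreover have "\<tau>' = []"
  proof (rule ccontr)
    assume "\<tau>' \<noteq> []"
    then have "length \<rho> + hd \<tau>' \<le> x" by (intro far) (simp add: tau \<open>\<rho>' = []\<close>)
    then show False using x pos[of "hd \<tau>'"] \<open>\<tau>' \<noteq> []\<close> by (simp add: tau)
  qed
  ultimately have "\<pi> = [x, 1 + y]" "x \<le> 1"
    using x by (auto simp: dec(5) perm_sum_def rho tau)
  then show ?thesis
    by (auto simp: inversions_def less_Suc_eq numeral_2_eq_2 nth_Cons')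
qed

lemma indec_avoiders_iff:
  "\<pi> \<in> indec_avoiders k {[1,2,3], [1,3,2], [2,1,3]} \<longleftrightarrow>
    \<pi> \<in> avoiders (length \<pi>) \<and> \<pi> \<noteq> [] \<and> \<not> decomposable \<pi> \<and> card (inversions \<pi>) = k"
proof (cases "perm_word \<pi>")
  case True
  then show ?thesis
    using avoids_iff_far_inverted[of \<pi>]
    unfolding indec_avoiders_def indecomposable_def avoiders_def
    by (auto simp: perm_word_iff)
qed (auto simp: indec_avoiders_def indecomposable_def avoiders_def)

lemma avoider_deficit_le:
  assumes "\<pi> \<in> avoiders_with N m"
  shows "2 * m \<le> N"
proof -
  have "0 < card (avoiders_with N m)" using assms by (auto simp: card_gt_0_iff)
  then have "m \<le> N - m" by (simp add: card_avoiders_with)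
  then show ?thesis by simp
qed

lemma avoiders_with_length:
  assumes "\<pi> \<in> avoiders N"
  shows "\<pi> \<in> avoiders_with N ((N choose 2) - card (inversions \<pi>))"
  using assms card_inversions_le[of \<pi>] by (auto simp: avoiders_with_def avoiders_def)

lemma indec_avoiders_diag_index:
  assumes "2 \<le> n"
  shows "indec_avoiders (diag_index (n, m)) {[1,2,3], [1,3,2], [2,1,3]} = avoiders_with (n + m) m"
proof (intro equalityI subsetI)
  fix \<pi> assume "\<pi> \<in> indec_avoiders (diag_index (n, m)) {[1,2,3], [1,3,2], [2,1,3]}"
  then have pi: "\<pi> \<in> avoiders (length \<pi>)" "card (inversions \<pi>) = diag_index (n, m)"
    unfolding indec_avoiders_iff by blast+
  define N where "N = length \<pi>"
  define d where "d = (N choose 2) - card (inversions \<pi>)"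
  have piN: "\<pi> \<in> avoiders_with N d"
    using avoiders_with_length[OF pi(1)] by (simp add: N_def d_def)
  then have d: "2 * d \<le> N" by (rule avoider_deficit_le)
  have eq: "diag_index (n, m) + d = N choose 2"
    using piN pi(2) by (simp add: avoiders_with_def)
  have pos: "1 \<le> diag_index (n, m)" using assms by (simp add: diag_index_def)
  \<comment> \<open>Two missing inversions need length at least four, and for length two the existing inversion
    leaves none missing; so \<open>N - d\<close> is always at least two.\<close>
  have "2 \<le> N"
  proof (rule ccontr)
    assume "\<not> 2 \<le> N"
    then have "N choose 2 = 0" by simp
    then show False using eq pos by linarith
  qed
  moreover have "d = 0" if "N = 2" using eq pos that by simp
  ultimately have ge: "2 \<le> N - d" using d by (cases "N = 2"; cases "N = 3") auto
  have "diag_index (N - d, d) = diag_index (n, m)"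
    using diag_index_add[OF ge, of d] eq d by simp
  then have "(N - d, d) = (n, m)"
    by (rule inj_onD[OF diag_index_inj]) (use ge assms in simp_all)
  then have "N = n + m" "d = m" using d by auto
  then show "\<pi> \<in> avoiders_with (n + m) m" using piN by simp
next
  fix \<pi> assume pi: "\<pi> \<in> avoiders_with (n + m) m"
  have inv: "card (inversions \<pi>) = diag_index (n, m)"
    using pi diag_index_add[OF assms, of m] by (simp add: avoiders_with_def)
  then have "inversions \<pi> \<noteq> {}" using assms by (auto simp: diag_index_def)
  then have "\<not> decomposable \<pi>"
    using far_inverted_decomposable pi by (auto simp: avoiders_with_def avoiders_def)
  then show "\<pi> \<in> indec_avoiders (diag_index (n, m)) {[1,2,3], [1,3,2], [2,1,3]}"
    unfolding indec_avoiders_iff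
    using inv pi assms by (auto simp: avoiders_with_def avoiders_def)
qed

lemma card_indec_avoiders_diag_index:
  assumes "2 \<le> n"
  shows "card (indec_avoiders (diag_index (n, m)) {[1,2,3], [1,3,2], [2,1,3]}) = n choose m"
  unfolding indec_avoiders_diag_index[OF assms] card_avoiders_with by simp

lemma indec_avoiders_0: "indec_avoiders 0 {[1,2,3], [1,3,2], [2,1,3]} = {[1]}"
proof (intro equalityI subsetI)
  fix \<pi> assume "\<pi> \<in> indec_avoiders 0 {[1,2,3], [1,3,2], [2,1,3]}"
  then have pi: "\<pi> \<in> avoiders (length \<pi>)" "\<pi> \<noteq> []" "\<not> decomposable \<pi>" "inversions \<pi> = {}"
    unfolding indec_avoiders_iff using finite_inversions[of \<pi>] by auto
  have "length \<pi> \<le> 1"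
  proof (rule ccontr)
    assume "\<not> length \<pi> \<le> 1"
    moreover have "indecomposable \<pi>"
      using pi by (simp add: indecomposable_def avoiders_def)
    ultimately show False
      using pi(4) by (auto elim: indecomposable_cut[of \<pi> 1])
  qed
  then have "length \<pi> = Suc 0" using pi(2) by (cases \<pi>) auto
  then show "\<pi> \<in> {[1]}" using pi(1) by (simp add: avoiders_1)
next
  fix \<pi> :: "nat list" assume "\<pi> \<in> {[1]}"
  moreover have "\<not> decomposable [1]"
    by (auto simp: decomposable_def perm_sum_def Cons_eq_append_conv)
  moreover have "inversions [1] = {}" by (auto simp: inversions_def)
  ultimately show "\<pi> \<in> indec_avoiders 0 {[1,2,3], [1,3,2], [2,1,3]}"
    unfolding indec_avoiders_iff using avoiders_1 by simp
qed

section \<open>The generating function\<close>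

text \<open>
  Distributing the leading power, the summand for \<open>d\<close> consists of the terms
  \<open>(n choose (d - n)) * x ^ diag_index (n, d - n)\<close>. By injectivity of \<^const>\<open>diag_index\<close>, a
  coefficient of positive index is contributed by a single diagonal.
\<close>

lemma diagonal_term_nth:
  assumes "2 \<le> n0"
  shows "fps_nth (fps_X ^ (1 + ((d - 1) choose 2)) *
      (\<Sum>n=2..d. of_nat (n choose (d - n)) * fps_X ^ (n - 2)) :: int fps) (diag_index (n0, m0)) =
    (if n0 + m0 = d then int (n0 choose m0) else 0)" (is "fps_nth ?g ?k = _")
proof -
  have "?g = (\<Sum>n=2..d. of_nat (n choose (d - n)) * fps_X ^ diag_index (n, d - n))"
    unfolding sum_distrib_left
  proof (rule sum.cong)
    fix n assume "n \<in> {2..d}"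
    then have "diag_index (n, d - n) = 1 + ((d - 1) choose 2) + (n - 2)"
      by (auto simp: diag_index_def)
    then show "fps_X ^ (1 + ((d - 1) choose 2)) * (of_nat (n choose (d - n)) * fps_X ^ (n - 2)) =
        (of_nat (n choose (d - n)) * fps_X ^ diag_index (n, d - n) :: int fps)"
      by (simp add: power_add mult_ac)
  qed simp
  then have "fps_nth ?g ?k =
      (\<Sum>n=2..d. if diag_index (n, d - n) = ?k then int (n choose (d - n)) else 0)"
    by (auto simp: fps_sum_nth fps_of_nat[symmetric] fps_X_power_nth intro!: sum.cong)
  also have "\<dots> = (\<Sum>n=2..d. if n = n0 \<and> n0 + m0 = d then int (n0 choose m0) else 0)"
  proof (rule sum.cong)
    fix n assume n: "n \<in> {2..d}"
    then have "diag_index (n, d - n) = ?k \<longleftrightarrow> (n, d - n) = (n0, m0)"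
      using inj_on_eq_iff[OF diag_index_inj, of "(n, d - n)" "(n0, m0)"] assms by auto
    then show "(if diag_index (n, d - n) = ?k then int (n choose (d - n)) else 0) =
        (if n = n0 \<and> n0 + m0 = d then int (n0 choose m0) else 0)"
      using n by auto
  qed simp
  also have "\<dots> = (if n0 + m0 = d then int (n0 choose m0) else 0)"
    using assms by auto
  finally show ?thesis .
qed

text \<open>
  Power series converge when each coefficient is eventually constant, and here the coefficient at
  the position of \<open>(n, m)\<close> is settled once \<open>n + m\<close> is among the indices summed.
\<close>

lemma diagonal_terms_has_sum:
  assumes a: "\<And>n m. 2 \<le> n \<Longrightarrow> a (diag_index (n, m)) = n choose m" and a0: "a 0 = 1"
  shows "((\<lambda>d. fps_X ^ (1 + ((d - 1) choose 2)) *
      (\<Sum>n=2..d. of_nat (n choose (d - n)) * fps_X ^ (n - 2)) :: int fps) has_sum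
    (Abs_fps (\<lambda>k. int (a k)) - 1 - fps_X)) {3..}" (is "(?g has_sum ?L) _")
  unfolding has_sum_def tendsto_fps_iff
proof
  fix k
  show "\<forall>\<^sub>F F in finite_subsets_at_top {3..}. fps_nth (sum ?g F) k = fps_nth ?L k"
  proof (cases "k = 0")
    case True
    then show ?thesis by (simp add: fps_sum_nth a0)
  next
    case False
    then obtain n m where nm: "2 \<le> n" "k = diag_index (n, m)"
      using diag_index_surj[of k] by auto
    have sum: "fps_nth (sum ?g F) k = (if n + m \<in> F then int (a k) else 0)" if "finite F" for F
      unfolding fps_sum_nth nm(2) diagonal_term_nth[OF nm(1)] using that
      by (simp add: a nm(1))
    show ?thesis
    proof (cases "k = 1")
      case True
      \<comment> \<open>This is the position of \<open>(2, 0)\<close>, on the diagonal 2, which the sum omits.\<close>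
      have "diag_index (2, 0) = 1" by (simp add: diag_index_def)
      then have "(n, m) = (2, 0)"
        using inj_on_eq_iff[OF diag_index_inj, of "(n, m)" "(2, 0)"] nm True by auto
      then have "fps_nth (sum ?g F) k = fps_nth ?L k" if "finite F" "F \<subseteq> {3..}" for F
      proof -
        have "n + m \<notin> F" using that(2) \<open>(n, m) = (2, 0)\<close> by auto
        moreover have "a 1 = 1" using a[of 2 0] \<open>diag_index (2, 0) = 1\<close> by simp
        ultimately show ?thesis unfolding sum[OF that(1)] by (simp add: True)
      qed
      then show ?thesis
        by (intro eventually_finite_subsets_at_top_weakI) auto
    next
      case k: False
      have "n + m \<noteq> 2"
      proof
        assume "n + m = 2"
        then have "n = 2" "m = 0" using nm(1) by auto
        then show False using nm k by (simp add: diag_index_def)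
      qed
      then have "n + m \<in> {3..}" using nm(1) by simp
      then have "\<forall>\<^sub>F F in finite_subsets_at_top {3..}. finite F \<and> n + m \<in> F"
        unfolding eventually_finite_subsets_at_top by (intro exI[of _ "{n + m}"]) auto
      then show ?thesis
      proof eventually_elim
        case (elim F)
        then show ?case using sum[of F] k False by simp
      qed
    qed
  qed
qed

theorem theorem21:
  fixes a :: "nat \<Rightarrow> nat"
  defines "a \<equiv> \<lambda>k. card (indec_avoiders k {[1,2,3], [1,3,2], [2,1,3]})"
  shows "a 0 = 1 choose 1
    \<and> (\<exists>e :: nat \<Rightarrow> nat \<times> nat.
         bij_betw e {1..} {(n, m). 2 \<le> n}
         \<and> (\<forall>j\<ge>1. \<forall>k\<ge>1. j < k \<longrightarrow> diag_less (e j) (e k))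
         \<and> (\<forall>k\<ge>1. a k = fst (e k) choose snd (e k)))
    \<and> (\<lambda>d. fps_X ^ (1 + ((d - 1) choose 2)) *
          (\<Sum>n=2..d. of_nat (n choose (d - n)) * fps_X ^ (n - 2)) :: int fps) summable_on {3..}
    \<and> Abs_fps (\<lambda>k. int (a k)) = 1 + fps_X +
        (\<Sum>\<^sub>\<infinity>d\<in>{3..}. fps_X ^ (1 + ((d - 1) choose 2)) *
          (\<Sum>n=2..d. of_nat (n choose (d - n)) * fps_X ^ (n - 2)))"
proof -
  have a0: "a 0 = 1"
    unfolding a_def indec_avoiders_0 by simp
  have a: "a (diag_index (n, m)) = n choose m" if "2 \<le> n" for n m
    unfolding a_def using that by (rule card_indec_avoiders_diag_index)
  define e where "e = inv_into {(n, m). 2 \<le> n} diag_index"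
  have bij: "bij_betw e {1..} {(n, m). 2 \<le> n}"
    unfolding e_def by (rule bij_betw_inv_into[OF diag_index_bij])
  have e: "2 \<le> fst (e k)" "diag_index (e k) = k" if "1 \<le> k" for k
    using bij_betwE[OF bij] bij_betw_inv_into_right[OF diag_index_bij, of k] that
    by (fastforce simp: e_def split_beta)+
  have "diag_less (e j) (e k)" if "1 \<le> j" "1 \<le> k" "j < k" for j k
    using diag_less_total[of "e j" "e k"] diag_index_strict_mono[of "e k" "e j"]
      e[of j] e[of k] that
    by (metis less_asym less_irrefl)
  moreover have "a k = fst (e k) choose snd (e k)" if "1 \<le> k" for k
    using a[of "fst (e k)" "snd (e k)"] e[OF that] by simp
  moreover note S = diagonal_terms_has_sum[of a, OF a a0]
  ultimately show ?thesis
    using bij a0 has_sum_imp_summable[OF S] infsumI[OF S] by auto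
qed

end
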